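(* Let $G=(V,E)$ be a finite simple undirected graph with maximum vertex degree $\Delta(G)$. Then \[\Delta(G) \le \mathrm{RTD}(\mathcal{C}_{star}(G)) \le \Delta(G)+1 .\]
   Context: For a vertex $x$, $N_G^o(x)=\{y : \{x,y\}\in E\}$ is its open neighborhood. The concept class $\mathcal{C}_{star}(G)$ over the domain $V$ is $\{X\cup\{x\} : x\in V,\ X\subseteq N_G^o(x)\}$; concepts are subsets of $V$. For a finite concept class $\mathcal{C}$ over a finite domain $\mathcal{X}$, a teaching set for $C\in\mathcal{C}$ is a set $D\subseteq \mathcal{X}$ such that for every $C'\in\mathcal{C}\setminus\{C\}$ there is $x\in D$ with ($x\in C \iff x\notin C'$). $\mathrm{TD}(C,\mathcal{C})$ is the minimum size of such a set, and $\mathrm{TD}_{min}(\mathcal{C})=\min_{C\in\mathcal{C}}\mathrm{TD}(C,\mathcal{C})$. Let $\mathcal{C}_{min}=\{C\in\mathcal{C}: \mathrm{TD}(C,\mathcal{C})=\mathrm{TD}_{min}(\mathcal{C})\}$. The recursive teaching dimension is defined recursively by $\mathrm{RTD}(\mathcal{C})=\mathrm{TD}_{min}(\mathcal{C})$ if $\mathcal{C}=\mathcal{C}_{min}$, and $\mathrm{RTD}(\mathcal{C})=\max\{\mathrm{TD}_{min}(\mathcal{C}),\mathrm{RTD}(\mathcal{C}\setminus\mathcal{C}_{min})\}$ otherwise. *)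

theory Defs
  imports Main
begin

definition simple_graph :: "'a set \<Rightarrow> 'a set set \<Rightarrow> bool" where
  "simple_graph V E \<longleftrightarrow> finite V \<and> (\<forall>e\<in>E. e \<subseteq> V \<and> card e = 2)"

definition open_nbhd :: "'a set set \<Rightarrow> 'a \<Rightarrow> 'a set" where
  "open_nbhd E x = {y. {x, y} \<in> E}"

definition degree :: "'a set set \<Rightarrow> 'a \<Rightarrow> nat" where
  "degree E x = card (open_nbhd E x)"

text \<open>Unspecified for \<^term>\<open>V = {}\<close>.\<close>

definition max_degree :: "'a set \<Rightarrow> 'a set set \<Rightarrow> nat" where
  "max_degree V E = Max (degree E ` V)"

definition star_class :: "'a set \<Rightarrow> 'a set set \<Rightarrow> 'a set set" where
  "star_class V E = {X \<union> {x} | X x. x \<in> V \<and> X \<subseteq> open_nbhd E x}"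

text \<open>Below, \<^term>\<open>V\<close> is the domain and \<^term>\<open>\<C>\<close> the concept class.\<close>

definition teaching_set :: "'a set \<Rightarrow> 'a set set \<Rightarrow> 'a set \<Rightarrow> 'a set \<Rightarrow> bool" where
  "teaching_set V \<C> C D \<longleftrightarrow> D \<subseteq> V \<and> (\<forall>C'\<in>\<C> - {C}. \<exists>x\<in>D. x \<in> C \<longleftrightarrow> x \<notin> C')"

text \<open>The minimum is over a nonempty finite set whenever \<^term>\<open>V\<close> is finite and
  all concepts are subsets of \<^term>\<open>V\<close>, since \<^term>\<open>V\<close> itself is then a teaching set.\<close>

definition TD :: "'a set \<Rightarrow> 'a set set \<Rightarrow> 'a set \<Rightarrow> nat" where
  "TD V \<C> C = Min {card D | D. teaching_set V \<C> C D}"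

definition TD_min :: "'a set \<Rightarrow> 'a set set \<Rightarrow> nat" where
  "TD_min V \<C> = Min (TD V \<C> ` \<C>)"

definition easiest :: "'a set \<Rightarrow> 'a set set \<Rightarrow> 'a set set" where
  "easiest V \<C> = {C \<in> \<C>. TD V \<C> C = TD_min V \<C>}"

lemma easiest_subset: "easiest V \<C> \<subseteq> \<C>"
  by (auto simp: easiest_def)

lemma easiest_nonempty:
  assumes "finite \<C>" "\<C> \<noteq> {}"
  shows "easiest V \<C> \<noteq> {}"
proof -
  have "TD_min V \<C> \<in> TD V \<C> ` \<C>"
    unfolding TD_min_def using assms by (intro Min_in) auto
  then show ?thesis by (auto simp: easiest_def)
qed

text \<open>The test \<^term>\<open>infinite \<C>\<close> only makes the function total; for finite classes the
  equation is the usual recursion. The value on the empty class is unspecified, but a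
  recursive call never reaches it.\<close>

function RTD :: "'a set \<Rightarrow> 'a set set \<Rightarrow> nat" where
  "RTD V \<C> =
    (if infinite \<C> \<or> \<C> = easiest V \<C> then TD_min V \<C>
     else max (TD_min V \<C>) (RTD V (\<C> - easiest V \<C>)))"
  by auto
termination
proof (relation "measure (\<lambda>(V, \<C>). card \<C>)", goal_cases)
  case (2 V \<C>)
  then have fin: "finite \<C>" and ne: "\<C> \<noteq> easiest V \<C>" by auto
  have "\<C> \<noteq> {}" using ne easiest_subset[of V \<C>] by auto
  then have "\<C> - easiest V \<C> \<subset> \<C>"
    using easiest_nonempty[OF fin] easiest_subset[of V \<C>] by blast
  then show ?case using fin by (simp add: psubset_card_mono)
qed simp

declare RTD.simps [simp del]

end

theory Submission
  imports Defs
begin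

text \<open>The recursive teaching dimension of a class is the maximum of \<^term>\<open>TD_min\<close> over its
  nonempty subclasses: look at the first round of the recursion that removes a member of the
  subclass. For the lower bound, the subclass of all stars centred at a vertex of maximum degree
  is a cube on its neighbourhood, so every concept needs every neighbour in its teaching set. For
  the upper bound, a concept that is inclusion-maximal in a subclass is its own teaching set, and
  a star has at most \<open>\<Delta> + 1\<close> elements.\<close>

lemma finite_teaching_set_cards:
  assumes "finite V"
  shows "finite {card D | D. teaching_set V \<C> C D}"
proof (rule finite_subset)
  show "{card D | D. teaching_set V \<C> C D} \<subseteq> card ` Pow V"
    by (auto simp: teaching_set_def)
qed (use assms in simp)

lemma TD_le:
  assumes "finite V" "teaching_set V \<C> C D"
  shows "TD V \<C> C \<le> card D"
  unfolding TD_def using assms by (intro Min_le finite_teaching_set_cards) auto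

lemma TD_attained:
  assumes "finite V" "\<C> \<subseteq> Pow V" "C \<in> \<C>"
  obtains D where "teaching_set V \<C> C D" "card D = TD V \<C> C"
proof -
  have "teaching_set V \<C> C V"
    using assms by (auto simp: teaching_set_def)
  then have "{card D | D. teaching_set V \<C> C D} \<noteq> {}"
    by blast
  then have "TD V \<C> C \<in> {card D | D. teaching_set V \<C> C D}"
    unfolding TD_def using assms by (intro Min_in finite_teaching_set_cards)
  then show ?thesis using that by auto
qed

text \<open>Shrinking the class leaves fewer rivals to separate from \<open>C\<close>, so an optimal
  teaching set for the larger class still works.\<close>

lemma TD_mono:
  assumes "finite V" "\<C> \<subseteq> Pow V" "\<C>' \<subseteq> \<C>" "C \<in> \<C>"
  shows "TD V \<C>' C \<le> TD V \<C> C"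
proof -
  obtain D where "teaching_set V \<C> C D" and card_D: "card D = TD V \<C> C"
    using assms TD_attained by blast
  then have "teaching_set V \<C>' C D"
    using assms(3) unfolding teaching_set_def by blast
  then show ?thesis
    using TD_le[OF assms(1)] card_D by metis
qed

lemma TD_min_le:
  assumes "finite \<C>" "C \<in> \<C>"
  shows "TD_min V \<C> \<le> TD V \<C> C"
  unfolding TD_min_def using assms by auto

text \<open>Induction along the recursion: while a round removes nothing from \<open>\<C>'\<close>,
  the whole subclass survives into the next call.\<close>

lemma TD_min_le_RTD:
  assumes "finite V" "\<C> \<subseteq> Pow V" "\<C>' \<subseteq> \<C>" "\<C>' \<noteq> {}"
  shows "TD_min V \<C>' \<le> RTD V \<C>"
  using assms
proof (induction V \<C> rule: RTD.induct)
  case (1 V \<C>)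
  have fin: "finite \<C>"
    using 1 by (meson finite_Pow_iff finite_subset)
  show ?case
  proof (cases "\<C>' \<inter> easiest V \<C> = {}")
    case True
    then have "\<C> \<noteq> easiest V \<C>"
      using 1 by auto
    moreover have "TD_min V \<C>' \<le> RTD V (\<C> - easiest V \<C>)"
      using 1 True calculation fin by blast
    ultimately show ?thesis
      using fin by (subst RTD.simps) simp
  next
    case False
    then obtain C where C: "C \<in> \<C>'" "C \<in> \<C>" "TD V \<C> C = TD_min V \<C>"
      by (auto simp: easiest_def)
    \<comment> \<open>The removed concept \<open>C\<close> links both classes: by monotonicity its
      teaching dimension in \<open>\<C>'\<close> is at most that in \<open>\<C>\<close>, which
      equals \<open>TD_min V \<C>\<close>.\<close>
    have "TD_min V \<C>' \<le> TD V \<C>' C"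
      using C fin 1 by (meson TD_min_le finite_subset)
    also have "\<dots> \<le> TD V \<C> C"
      using C 1 by (intro TD_mono)
    also have "\<dots> \<le> RTD V \<C>"
      using C by (subst RTD.simps) simp
    finally show ?thesis .
  qed
qed

text \<open>Converse half of the maximum formula: each class met by the recursion is a nonempty
  subclass of the original one, and \<open>RTD\<close> is the maximum of their \<open>TD_min\<close>
  values.\<close>

lemma RTD_le:
  assumes "finite \<C>" "\<C> \<noteq> {}"
    and "\<And>\<C>'. \<C>' \<subseteq> \<C> \<Longrightarrow> \<C>' \<noteq> {} \<Longrightarrow> TD_min V \<C>' \<le> k"
  shows "RTD V \<C> \<le> k"
  using assms
proof (induction V \<C> rule: RTD.induct)
  case (1 V \<C>)
  have min: "TD_min V \<C> \<le> k"
    using 1 by auto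
  show ?case
  proof (cases "\<C> = easiest V \<C>")
    case True
    then show ?thesis
      using min by (subst RTD.simps) simp
  next
    case False
    then have "\<C> - easiest V \<C> \<noteq> {}"
      using easiest_subset[of V \<C>] by blast
    then have "RTD V (\<C> - easiest V \<C>) \<le> k"
      using 1 False by (simp add: subset_iff)
    then show ?thesis
      using min by (subst RTD.simps) simp
  qed
qed

lemma TD_min_le_if_card_le:
  assumes "finite V" "\<C> \<subseteq> Pow V" "\<C> \<noteq> {}" and "\<And>C. C \<in> \<C> \<Longrightarrow> card C \<le> k"
  shows "TD_min V \<C> \<le> k"
proof -
  have fin: "finite \<C>"
    using assms by (meson finite_Pow_iff finite_subset)
  then obtain C where C: "C \<in> \<C>" "\<And>C'. C' \<in> \<C> \<Longrightarrow> C \<subseteq> C' \<Longrightarrow> C = C'"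
    using assms(3) finite_has_maximal by metis
  \<comment> \<open>By maximality no other concept contains \<open>C\<close>, so each of them misses
    a point of \<open>C\<close>.\<close>
  have "teaching_set V \<C> C C"
    using C assms(2) unfolding teaching_set_def by blast
  then have "TD V \<C> C \<le> k"
    using TD_le assms(1,4) C(1) le_trans by blast
  then show ?thesis
    using TD_min_le[OF fin C(1)] le_trans by blast
qed

text \<open>Flipping one point of \<open>N\<close> gives a concept differing from the given one only
  there, so that point is forced into every teaching set. Disjointness from \<open>A\<close> keeps
  the flip visible.\<close>

lemma card_le_TD_min_cube:
  assumes "finite V" "N \<subseteq> V" "A \<subseteq> V" "N \<inter> A = {}"
  shows "card N \<le> TD_min V ((\<lambda>X. X \<union> A) ` Pow N)" (is "_ \<le> TD_min V ?\<C>")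
proof -
  have sub: "?\<C> \<subseteq> Pow V" and fin: "finite ?\<C>"
    using assms by (auto intro: finite_subset)
  have "card N \<le> TD V ?\<C> (X \<union> A)" if X: "X \<subseteq> N" for X
  proof -
    obtain D where D: "teaching_set V ?\<C> (X \<union> A) D" "card D = TD V ?\<C> (X \<union> A)"
      using TD_attained[OF assms(1) sub] X by blast
    have "N \<subseteq> D"
    proof
      fix y assume y: "y \<in> N"
      define Y where "Y = (if y \<in> X then X - {y} else insert y X)"
      have Y: "z \<in> X \<longleftrightarrow> z \<in> Y" if "z \<noteq> y" for z
        using that by (simp add: Y_def)
      have "Y \<subseteq> N" "Y \<union> A \<noteq> X \<union> A"
        using X y assms(4) by (auto simp: Y_def)
      then obtain z where "z \<in> D" "z \<in> X \<union> A \<longleftrightarrow> z \<notin> Y \<union> A"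
        using D(1) unfolding teaching_set_def by blast
      then show "y \<in> D"
        using Y by (metis Un_iff)
    qed
    moreover have "finite D"
      using D(1) assms(1) finite_subset unfolding teaching_set_def by blast
    ultimately show ?thesis
      using D(2) card_mono by metis
  qed
  \<comment> \<open>The minimum is attained at some \<open>X \<union> A\<close>, where the bound
    just shown applies.\<close>
  moreover have "TD_min V ?\<C> \<in> TD V ?\<C> ` ?\<C>"
    unfolding TD_min_def using fin by (intro Min_in) auto
  ultimately show ?thesis
    by auto
qed

text \<open>There are no loops: \<open>{x, x}\<close> has cardinality 1, not 2.\<close>

lemma open_nbhd_subset:
  assumes "simple_graph V E"
  shows "open_nbhd E x \<subseteq> V - {x}"
  using assms by (fastforce simp: simple_graph_def open_nbhd_def)

lemma card_star_le:
  assumes "simple_graph V E" "C \<in> star_class V E"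
  shows "card C \<le> max_degree V E + 1"
proof -
  obtain X x where C: "C = X \<union> {x}" "x \<in> V" "X \<subseteq> open_nbhd E x"
    using assms(2) by (auto simp: star_class_def)
  have finV: "finite V"
    using assms(1) by (simp add: simple_graph_def)
  then have "finite (open_nbhd E x)"
    using open_nbhd_subset[OF assms(1), of x] by (meson finite_Diff finite_subset)
  then have "card X \<le> degree E x"
    using C(3) by (simp add: degree_def card_mono)
  also have "\<dots> \<le> max_degree V E"
    using finV C(2) by (simp add: max_degree_def)
  \<comment> \<open>The centre \<open>x\<close> contributes the extra 1.\<close>
  finally show ?thesis
    using card_Un_le[of X "{x}"] C(1) by simp
qed

theorem theorem2:
  fixes V :: "'a set" and E :: "'a set set"
  assumes "simple_graph V E" and "V \<noteq> {}"
  shows "max_degree V E \<le> RTD V (star_class V E)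
    \<and> RTD V (star_class V E) \<le> max_degree V E + 1"
proof
  have finV: "finite V"
    using assms(1) by (simp add: simple_graph_def)
  have sub: "star_class V E \<subseteq> Pow V"
    using open_nbhd_subset[OF assms(1)] by (fastforce simp: star_class_def)
  have fin: "finite (star_class V E)"
    using finV sub by (meson finite_Pow_iff finite_subset)
  have "max_degree V E \<in> degree E ` V"
    unfolding max_degree_def using finV assms(2) by (intro Max_in) auto
  then obtain x where x: "x \<in> V" "max_degree V E = card (open_nbhd E x)"
    by (auto simp: degree_def)
  \<comment> \<open>This is the cube with fixed part \<open>{x}\<close>, disjoint from the
    neighbourhood by the absence of loops.\<close>
  let ?\<C> = "(\<lambda>X. X \<union> {x}) ` Pow (open_nbhd E x)"
  have cube: "?\<C> \<subseteq> star_class V E" "?\<C> \<noteq> {}"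
    using x(1) by (auto simp: star_class_def)
  have "card (open_nbhd E x) \<le> TD_min V ?\<C>"
    using open_nbhd_subset[OF assms(1), of x] x finV by (intro card_le_TD_min_cube) auto
  also have "\<dots> \<le> RTD V (star_class V E)"
    using TD_min_le_RTD[OF finV sub cube] .
  finally show "max_degree V E \<le> RTD V (star_class V E)"
    using x(2) by simp
  show "RTD V (star_class V E) \<le> max_degree V E + 1"
  proof (rule RTD_le[OF fin])
    show "star_class V E \<noteq> {}"
      using cube by blast
    show "TD_min V \<C> \<le> max_degree V E + 1" if "\<C> \<subseteq> star_class V E" "\<C> \<noteq> {}" for \<C>
      using that sub card_star_le[OF assms(1)] by (intro TD_min_le_if_card_le finV) auto
  qed
qed

end
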